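(* The states in $\mathbb{C}^2\otimes\mathbb{C}^2$ that are entangled, diagonal, and orthogonal to both $|00\rangle_{AB}$ and $|11\rangle_{AB}$ are exactly the states characterized by two non-zero complex numbers $c,d$ with $|c|^2+|d|^2=1$ through the Schmidt decomposition $$|\mathrm{ppE}\rangle_{AB}=|c|\left(\frac{c}{|c|}|01\rangle_{AB}\right)+|d|\left(\frac{d}{|d|}|10\rangle_{AB}\right).$$
   Context: $|0\rangle,|1\rangle$ is the standard basis of $\mathbb{C}^2$ and $|jk\rangle_{AB}=|j\rangle_A\otimes|k\rangle_B$. A state is a unit vector; a state in $\mathbb{C}^2\otimes\mathbb{C}^2$ is a product state if it equals $|u\rangle\otimes|v\rangle$, and entangled otherwise. A state $\sum_{j,k}c_{jk}|jk\rangle_{AB}$ is called diagonal if $c_{00}^*c_{01}+c_{10}^*c_{11}=0$. A Schmidt decomposition of a state is an expression $\sum_j\lambda_j|u_j\rangle\otimes|v_j\rangle$ with $\lambda_j\ge 0$ and $\{|u_j\rangle\}$, $\{|v_j\rangle\}$ orthonormal families in $\mathbb{C}^2$ (phases may be absorbed into either tensor factor). *)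

theory Defs
  imports "HOL-Analysis.Analysis"
begin

text \<open>
  \<open>\<complex>\<^sup>2\<close> is \<open>complex ^ 2\<close>, whose index type \<open>2\<close> has exactly the elements \<open>0\<close> and \<open>1\<close>;
  \<open>\<complex>\<^sup>2 \<otimes> \<complex>\<^sup>2\<close> is \<open>complex ^ (2 \<times> 2)\<close>, where the component at \<open>(j, k)\<close> is the coefficient of
  the basis vector \<open>|jk\<rangle>\<close>.
\<close>

type_synonym qubit = "complex ^ 2"
type_synonym qubit_pair = "complex ^ (2 \<times> 2)"

text \<open>The inner product in \<open>complex ^ 'n\<close> provided by the library is real-valued, hence a
  separate Hermitian one, antilinear in the first argument. The library norm is the one it
  induces, see \<open>cinner_self\<close> below.\<close>

definition cinner :: "complex ^ 'n \<Rightarrow> complex ^ 'n \<Rightarrow> complex" where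
  "cinner x y = (\<Sum>i\<in>UNIV. cnj (x $ i) * y $ i)"

definition tensor :: "qubit \<Rightarrow> qubit \<Rightarrow> qubit_pair" (infixl "\<otimes>" 75) where
  "u \<otimes> v = (\<chi> p. u $ fst p * v $ snd p)"

definition ket :: "2 \<Rightarrow> qubit" where
  "ket j = axis j 1"

definition ketAB :: "2 \<Rightarrow> 2 \<Rightarrow> qubit_pair" where
  "ketAB j k = ket j \<otimes> ket k"

definition state :: "complex ^ 'n \<Rightarrow> bool" where
  "state \<psi> \<longleftrightarrow> norm \<psi> = 1"

definition product_state :: "qubit_pair \<Rightarrow> bool" where
  "product_state \<psi> \<longleftrightarrow> state \<psi> \<and> (\<exists>u v. state u \<and> state v \<and> \<psi> = u \<otimes> v)"

definition entangled :: "qubit_pair \<Rightarrow> bool" where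
  "entangled \<psi> \<longleftrightarrow> state \<psi> \<and> \<not> product_state \<psi>"

text \<open>The coefficient of \<open>|jk\<rangle>\<close> in \<open>\<psi>\<close> is \<open>\<psi> $ (j, k)\<close>, see \<open>ketAB_expansion\<close> below.\<close>

definition diagonal :: "qubit_pair \<Rightarrow> bool" where
  "diagonal \<psi> \<longleftrightarrow>
     cnj (\<psi> $ (0, 0)) * \<psi> $ (0, 1) + cnj (\<psi> $ (1, 0)) * \<psi> $ (1, 1) = 0"

definition orthonormal_family :: "(complex ^ 'n) list \<Rightarrow> bool" where
  "orthonormal_family vs \<longleftrightarrow>
     (\<forall>i<length vs. \<forall>j<length vs. cinner (vs ! i) (vs ! j) = (if i = j then 1 else 0))"

text \<open>The list \<open>ts\<close> of triples \<open>(\<lambda>\<^sub>j, u\<^sub>j, v\<^sub>j)\<close> stands for the expression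
  \<open>\<Sum>\<^sub>j \<lambda>\<^sub>j u\<^sub>j \<otimes> v\<^sub>j\<close>.\<close>

definition schmidt_decomposition ::
    "(real \<times> qubit \<times> qubit) list \<Rightarrow> qubit_pair \<Rightarrow> bool" where
  "schmidt_decomposition ts \<psi> \<longleftrightarrow>
     (\<forall>(l, u, v) \<in> set ts. l \<ge> 0) \<and>
     orthonormal_family (map (\<lambda>(l, u, v). u) ts) \<and>
     orthonormal_family (map (\<lambda>(l, u, v). v) ts) \<and>
     \<psi> = (\<Sum>(l, u, v)\<leftarrow>ts. complex_of_real l *s (u \<otimes> v))"

definition ppE :: "complex \<Rightarrow> complex \<Rightarrow> qubit_pair" where
  "ppE c d =
     complex_of_real (cmod c) *s ((c / complex_of_real (cmod c)) *s ketAB 0 1)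
     + complex_of_real (cmod d) *s ((d / complex_of_real (cmod d)) *s ketAB 1 0)"

lemma cinner_self: "cinner x x = complex_of_real ((norm x)\<^sup>2)"
proof -
  have "(norm x)\<^sup>2 = (\<Sum>i\<in>UNIV. (cmod (x $ i))\<^sup>2)"
    by (simp add: norm_vec_def L2_set_def sum_nonneg)
  then show ?thesis
    by (simp add: cinner_def complex_norm_square mult.commute del: of_real_power)
qed

lemma ketAB_nth: "ketAB j k $ (j', k') = (if j = j' \<and> k = k' then 1 else 0)"
  by (auto simp: ketAB_def tensor_def ket_def axis_def)

lemma ketAB_expansion: "\<psi> = (\<Sum>j\<in>UNIV. \<Sum>k\<in>UNIV. \<psi> $ (j, k) *s ketAB j k)"
proof -
  have "(\<Sum>j\<in>UNIV. \<Sum>k\<in>UNIV. \<psi> $ (j, k) *s ketAB j k) $ (a, b) = \<psi> $ (a, b)" for a b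
  proof -
    have "(\<Sum>j\<in>UNIV. \<Sum>k\<in>UNIV. \<psi> $ (j, k) *s ketAB j k) $ (a, b)
        = (\<Sum>j\<in>UNIV. \<Sum>k\<in>UNIV. if k = b then if j = a then \<psi> $ (j, k) else 0 else 0)"
      unfolding sum_component by (intro sum.cong refl) (simp add: ketAB_nth)
    then show ?thesis by simp
  qed
  then show ?thesis by (simp add: vec_eq_iff)
qed

end

theory Submission
  imports Defs
begin

text \<open>Orthogonality to \<open>|00\<rangle>\<close> and \<open>|11\<rangle>\<close> means that only the coefficients \<open>c = \<psi> $ (0, 1)\<close> and
  \<open>d = \<psi> $ (1, 0)\<close> survive, so diagonality is automatic. Every tensor \<open>u \<otimes> v\<close> satisfies
  \<open>c * d = \<psi> $ (0, 0) * \<psi> $ (1, 1) = 0\<close>, and conversely \<open>c|01\<rangle>\<close> and \<open>d|10\<rangle>\<close> are tensors;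
  hence such a state is entangled iff \<open>c\<close> and \<open>d\<close> are both non-zero.\<close>

text \<open>\<open>UNIV_2\<close> lists the elements as 1 and 2; arithmetic in this type is modulo
  2, so 2 is 0.\<close>

lemma UNIV_2_eq: "(UNIV :: 2 set) = {0, 1}"
proof -
  have "(2 :: 2) = 0" by simp
  then show ?thesis
    using exhaust_2 by (metis UNIV_2 insert_commute)
qed

lemma all_2_iff: "(\<forall>i::2. P i) \<longleftrightarrow> P 0 \<and> P 1"
  by (metis UNIV_2_eq UNIV_I insertE singletonD)

lemma sum_2_eq: "(\<Sum>i\<in>(UNIV :: 2 set). f i) = f 0 + f 1"
  by (simp add: UNIV_2_eq)

lemma sum_2_times_2: "(\<Sum>p\<in>(UNIV :: (2 \<times> 2) set). f p) = f (0, 0) + f (0, 1) + f (1, 0) + f (1, 1)"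
proof -
  have "(\<Sum>p\<in>(UNIV :: (2 \<times> 2) set). f p) = (\<Sum>j\<in>UNIV. \<Sum>k\<in>UNIV. f (j, k))"
    by (simp add: UNIV_Times_UNIV[symmetric] sum.cartesian_product del: UNIV_Times_UNIV)
  then show ?thesis
    by (simp add: sum_2_eq add.assoc)
qed

lemma ket_nth: "ket j $ i = (if i = j then 1 else 0)"
  by (simp add: ket_def axis_def)

lemma cinner_ket_ket: "cinner (ket i) (ket j) = (if i = j then 1 else 0)"
proof -
  have "cinner (ket i) (ket j) = (\<Sum>k\<in>UNIV. if k = i then if i = j then 1 else 0 else 0)"
    unfolding cinner_def by (intro sum.cong refl) (auto simp: ket_nth)
  then show ?thesis by simp
qed

lemma cinner_scale: "cinner (a *s x) (b *s y) = cnj a * b * cinner x y"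
  by (simp add: cinner_def sum_distrib_left algebra_simps)

lemma norm_scale_ket: "norm (a *s ket j) = cmod a"
proof -
  have "complex_of_real ((norm (a *s ket j))\<^sup>2) = complex_of_real ((cmod a)\<^sup>2)"
    unfolding cinner_self[symmetric] complex_norm_square
    by (simp add: cinner_scale cinner_ket_ket mult.commute)
  then show ?thesis
    by (simp only: of_real_eq_iff power2_eq_iff_nonneg norm_ge_zero)
qed

text \<open>Turns orthogonality to a basis vector into the vanishing of one coefficient.\<close>

lemma cinner_ketAB: "cinner (ketAB j k) \<psi> = \<psi> $ (j, k)"
proof -
  have "cinner (ketAB j k) \<psi> = (\<Sum>p\<in>UNIV. if p = (j, k) then \<psi> $ p else 0)"
    unfolding cinner_def by (intro sum.cong refl) (auto simp: ketAB_nth split: if_splits)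
  then show ?thesis by simp
qed

lemma tensor_scale_left: "(a *s u) \<otimes> v = a *s (u \<otimes> v)"
  by (simp add: vec_eq_iff tensor_def)

text \<open>The division by \<open>cmod c\<close> is harmless for \<open>c = 0\<close> as well: both sides are then zero.\<close>

lemma ppE_eq: "ppE c d = c *s ketAB 0 1 + d *s ketAB 1 0"
  by (simp add: ppE_def vec_eq_iff)

lemma ppE_nth:
  "ppE c d $ (0, 0) = 0" "ppE c d $ (0, 1) = c" "ppE c d $ (1, 0) = d" "ppE c d $ (1, 1) = 0"
  by (simp_all add: ppE_eq ketAB_nth)

lemma orthogonal_iff_ppE:
  "cinner (ketAB 0 0) \<psi> = 0 \<and> cinner (ketAB 1 1) \<psi> = 0 \<longleftrightarrow> (\<exists>c d. \<psi> = ppE c d)"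
proof
  assume "cinner (ketAB 0 0) \<psi> = 0 \<and> cinner (ketAB 1 1) \<psi> = 0"
  then have "\<psi> = ppE (\<psi> $ (0, 1)) (\<psi> $ (1, 0))"
    by (simp add: vec_eq_iff cinner_ketAB all_2_iff ppE_nth)
  then show "\<exists>c d. \<psi> = ppE c d" by blast
qed (auto simp: cinner_ketAB ppE_nth)

lemma diagonal_ppE: "diagonal (ppE c d)"
  by (simp add: diagonal_def ppE_nth)

lemma state_ppE_iff: "state (ppE c d) \<longleftrightarrow> (cmod c)\<^sup>2 + (cmod d)\<^sup>2 = 1"
  by (simp add: state_def norm_vec_def L2_set_def sum_2_times_2 ppE_nth)

text \<open>The coefficient matrix of a tensor has rank at most one, so its determinant
  vanishes.\<close>

lemma tensor_minor: "(u \<otimes> v) $ (0, 1) * (u \<otimes> v) $ (1, 0) = (u \<otimes> v) $ (0, 0) * (u \<otimes> v) $ (1, 1)"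
  by (simp add: tensor_def)

lemma entangled_ppE_iff:
  "entangled (ppE c d) \<longleftrightarrow> c \<noteq> 0 \<and> d \<noteq> 0 \<and> (cmod c)\<^sup>2 + (cmod d)\<^sup>2 = 1"
proof -
  have "product_state (ppE c d) \<longleftrightarrow> c * d = 0" if norm1: "(cmod c)\<^sup>2 + (cmod d)\<^sup>2 = 1"
  proof
    assume "product_state (ppE c d)"
    then obtain u v where "ppE c d = u \<otimes> v"
      by (auto simp: product_state_def)
    then show "c * d = 0"
      using tensor_minor[of u v] by (metis ppE_nth mult_zero_left)
  next
    have ket: "state (ket j)" for j
      using norm_scale_ket[of 1 j] by (simp add: state_def)
    assume "c * d = 0"
    then consider "c = 0" | "d = 0" by auto
    then have "\<exists>u v. state u \<and> state v \<and> ppE c d = u \<otimes> v"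
    proof cases
      case 1
      \<comment> \<open>Normalization leaves \<open>cmod d = 1\<close>, so \<open>d\<close> is a
        pure phase that the first factor can absorb.\<close>
      then have "state (d *s ket 1)"
        using norm1 by (simp add: state_def norm_scale_ket abs_square_eq_1)
      moreover have "ppE c d = (d *s ket 1) \<otimes> ket 0"
        using 1 by (simp add: ppE_eq tensor_scale_left ketAB_def)
      ultimately show ?thesis using ket by blast
    next
      case 2
      then have "state (c *s ket 0)"
        using norm1 by (simp add: state_def norm_scale_ket abs_square_eq_1)
      moreover have "ppE c d = (c *s ket 0) \<otimes> ket 1"
        using 2 by (simp add: ppE_eq tensor_scale_left ketAB_def)
      ultimately show ?thesis using ket by blast
    qed
    then show "product_state (ppE c d)"
      using norm1 by (simp add: product_state_def state_ppE_iff)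
  qed
  then show ?thesis
    by (auto simp: entangled_def state_ppE_iff)
qed

lemma cnj_mult_phase:
  assumes "c \<noteq> 0"
  shows "cnj (c / complex_of_real (cmod c)) * (c / complex_of_real (cmod c)) = 1"
proof -
  have "cmod (c / complex_of_real (cmod c)) = 1"
    using assms by (simp add: norm_divide)
  then show ?thesis
    by (metis complex_norm_square mult.commute of_real_1 one_power2)
qed

text \<open>The phases go into the first factors, leaving the positive coefficients
  \<open>cmod c\<close> and \<open>cmod d\<close>; unit phases do not disturb orthonormality. The
  second family is the basis in reversed order, to match 01 and 10.\<close>

lemma schmidt_decomposition_ppE:
  assumes "c \<noteq> 0" "d \<noteq> 0"
  shows "schmidt_decomposition
    [(cmod c, (c / complex_of_real (cmod c)) *s ket 0, ket 1),
     (cmod d, (d / complex_of_real (cmod d)) *s ket 1, ket 0)] (ppE c d)"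
proof -
  have "orthonormal_family
      [(c / complex_of_real (cmod c)) *s ket 0, (d / complex_of_real (cmod d)) *s ket 1]"
    \<comment> \<open>The conjugated quotients must keep the shape in which
      \<open>cnj_mult_phase\<close> states them, hence the deletion of
      \<open>complex_cnj_divide\<close>.\<close>
    unfolding orthonormal_family_def cinner_scale
    using cnj_mult_phase[OF assms(1)] cnj_mult_phase[OF assms(2)]
    by (simp add: less_Suc_eq all_conj_distrib cinner_scale cinner_ket_ket
        del: complex_cnj_divide)
  moreover have "orthonormal_family [ket 1, ket 0]"
    by (auto simp: orthonormal_family_def less_Suc_eq cinner_ket_ket)
  ultimately show ?thesis
    by (simp add: schmidt_decomposition_def ppE_def ketAB_def tensor_scale_left)
qed

theorem proposition10:
  "{\<psi>. entangled \<psi> \<and> diagonal \<psi> \<and> cinner (ketAB 0 0) \<psi> = 0 \<and> cinner (ketAB 1 1) \<psi> = 0}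
     = {ppE c d | c d. c \<noteq> 0 \<and> d \<noteq> 0 \<and> (cmod c)\<^sup>2 + (cmod d)\<^sup>2 = 1}
   \<and> (\<forall>c d. c \<noteq> 0 \<and> d \<noteq> 0 \<and> (cmod c)\<^sup>2 + (cmod d)\<^sup>2 = 1 \<longrightarrow>
        schmidt_decomposition
          [(cmod c, (c / complex_of_real (cmod c)) *s ket 0, ket 1),
           (cmod d, (d / complex_of_real (cmod d)) *s ket 1, ket 0)]
          (ppE c d))"
  \<comment> \<open>Both orthogonality conditions together become the form \<open>ppE c d\<close>,
    on which entanglement alone supplies the constraints on \<open>c\<close> and
    \<open>d\<close>.\<close>
  unfolding orthogonal_iff_ppE
  using entangled_ppE_iff diagonal_ppE schmidt_decomposition_ppE by blast

end
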